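(* Let $\Sigma$ be a finite alphabet of size $q$, let $d\ge 2$, and let $f_1,\dots,f_n:\Sigma^d\to\Sigma$ be bipermutive local rules forming a family of $n$ mutually orthogonal cellular automata ($n$-MOCA), with associated no-boundary cellular automata $F_1,\dots,F_n:\Sigma^{2(d-1)}\to\Sigma^{d-1}$. Let $S\in\{1,\dots,n\}$ and $R\in\Sigma^{d-1}$ be the secret index and the output block chosen by the dealer, and let $F_S^{-1}(R)=\{B_1,\dots,B_{q^{d-1}}\}$ be the set of shares, where the $B_i$ are distinct and player $P_i$ holds $B_i$. For each player $P_i$ define the family of subsets of $\Sigma^{2(d-1)}$ $$\mathcal{A}_i=\{A_{i,1},\dots,A_{i,n}\},\qquad A_{i,k}=F_k^{-1}(F_k(B_i))=\{x\in\Sigma^{2(d-1)}: F_k(x)=F_k(B_i)\}.$$ Then for any two distinct players $P_i,P_j$, the intersection $\mathcal{A}_i\cap\mathcal{A}_j$ (as sets of subsets of $\Sigma^{2(d-1)}$) consists of exactly one element, this element is the set $A_S=F_S^{-1}(R)$, and it uniquely identifies the secret rule $f_S$, i.e. the only index $k\in\{1,\dots,n\}$ for which $A_S=F_k^{-1}(y)$ for some $y\in\Sigma^{d-1}$ is $k=S$.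
   Context: A local rule $f:\Sigma^d\to\Sigma$ of diameter $d$ is bipermutive if, fixing $x_2,\dots,x_d$ to arbitrary constants, $x_1\mapsto f(x_1,\dots,x_d)$ is a permutation of $\Sigma$, and likewise, fixing $x_1,\dots,x_{d-1}$ to arbitrary constants, $x_d\mapsto f(x_1,\dots,x_d)$ is a permutation of $\Sigma$. The no-boundary cellular automaton $F:\Sigma^{2(d-1)}\to\Sigma^{d-1}$ with local rule $f$ is $$F(x_1,\dots,x_{2(d-1)})=(f(x_1,\dots,x_d),f(x_2,\dots,x_{d+1}),\dots,f(x_{d-1},\dots,x_{2(d-1)})).$$ Its Cayley table is the $q^{d-1}\times q^{d-1}$ matrix with rows, columns and entries indexed by $\Sigma^{d-1}$, whose entry in row $u$ and column $v$ is $F(u\|v)$, where $\|$ denotes concatenation. It is known that if $f$ is bipermutive this table is a Latin square (every row and every column is a permutation of $\Sigma^{d-1}$), and that $|F^{-1}(y)|=q^{d-1}$ for every $y\in\Sigma^{d-1}$. Two Latin squares $L_1,L_2$ of the same order are orthogonal if $(L_1(u,v),L_2(u,v))\ne(L_1(u',v'),L_2(u',v'))$ for all distinct coordinates $(u,v)\neq(u',v')$. Bipermutive rules $f_1,\dots,f_n$ form a family of $n$-MOCA if for all $i\ne j$ the Cayley tables of $F_i$ and $F_j$ are orthogonal Latin squares. The secret sharing protocol: the rules $f_1,\dots,f_n$ are public. The dealer chooses a secret index $S\in\{1,\dots,n\}$ and a block $R\in\Sigma^{d-1}$, computes $F_S^{-1}(R)=\{x\in\Sigma^{2(d-1)}:F_S(x)=R\}$,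 and gives its $q^{d-1}$ elements as shares, one to each of the players $P_1,\dots,P_{q^{d-1}}$. To recover the secret, two players $P_i,P_j$ each compute their families $\mathcal{A}_i,\mathcal{A}_j$ from their own share, and then compute the intersection $\mathcal{A}_i\cap\mathcal{A}_j$. *)

theory Defs
  imports "HOL-Library.NList" "HOL-Library.FuncSet"
begin

(* Sigma^m is nlists m Sigma; a local rule of diameter d is a function on lists that is only
   relevant on nlists d Sigma. *)

definition bipermutive :: "'a set \<Rightarrow> nat \<Rightarrow> ('a list \<Rightarrow> 'a) \<Rightarrow> bool" where
  "bipermutive \<Sigma> d f \<longleftrightarrow>
     f \<in> nlists d \<Sigma> \<rightarrow> \<Sigma> \<and>
     (\<forall>c \<in> nlists (d - 1) \<Sigma>. bij_betw (\<lambda>x. f (x # c)) \<Sigma> \<Sigma> \<and> bij_betw (\<lambda>x. f (c @ [x])) \<Sigma> \<Sigma>)"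

(* Cell i (counted from 0) is f applied to the d letters of x starting at position i. *)
definition no_boundary_ca :: "nat \<Rightarrow> ('a list \<Rightarrow> 'a) \<Rightarrow> 'a list \<Rightarrow> 'a list" where
  "no_boundary_ca d f x = map (\<lambda>i. f (take d (drop i x))) [0..<d - 1]"

definition cayley_table :: "nat \<Rightarrow> ('a list \<Rightarrow> 'a) \<Rightarrow> 'a list \<Rightarrow> 'a list \<Rightarrow> 'a list" where
  "cayley_table d f u v = no_boundary_ca d f (u @ v)"

(* A square matrix is a function L of row and column; rows, columns and entries all range over
   the same index set I. *)

definition latin_square :: "'b set \<Rightarrow> ('b \<Rightarrow> 'b \<Rightarrow> 'b) \<Rightarrow> bool" where
  "latin_square I L \<longleftrightarrow>
     (\<forall>u \<in> I. bij_betw (\<lambda>v. L u v) I I) \<and> (\<forall>v \<in> I. bij_betw (\<lambda>u. L u v) I I)"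

definition orthogonal_latin_squares ::
    "'b set \<Rightarrow> ('b \<Rightarrow> 'b \<Rightarrow> 'b) \<Rightarrow> ('b \<Rightarrow> 'b \<Rightarrow> 'b) \<Rightarrow> bool" where
  "orthogonal_latin_squares I L1 L2 \<longleftrightarrow>
     latin_square I L1 \<and> latin_square I L2 \<and>
     (\<forall>u \<in> I. \<forall>v \<in> I. \<forall>u' \<in> I. \<forall>v' \<in> I.
        (u, v) \<noteq> (u', v') \<longrightarrow> (L1 u v, L2 u v) \<noteq> (L1 u' v', L2 u' v'))"

definition moca :: "'a set \<Rightarrow> nat \<Rightarrow> nat \<Rightarrow> (nat \<Rightarrow> 'a list \<Rightarrow> 'a) \<Rightarrow> bool" where
  "moca \<Sigma> d n f \<longleftrightarrow>
     (\<forall>k \<in> {1..n}. bipermutive \<Sigma> d (f k)) \<and>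
     (\<forall>i \<in> {1..n}. \<forall>j \<in> {1..n}. i \<noteq> j \<longrightarrow>
        orthogonal_latin_squares (nlists (d - 1) \<Sigma>) (cayley_table d (f i)) (cayley_table d (f j)))"

definition ca_preimage :: "'a set \<Rightarrow> nat \<Rightarrow> ('a list \<Rightarrow> 'a) \<Rightarrow> 'a list \<Rightarrow> 'a list set" where
  "ca_preimage \<Sigma> d f y = {x \<in> nlists (2 * (d - 1)) \<Sigma>. no_boundary_ca d f x = y}"

definition share_family ::
    "'a set \<Rightarrow> nat \<Rightarrow> nat \<Rightarrow> (nat \<Rightarrow> 'a list \<Rightarrow> 'a) \<Rightarrow> 'a list \<Rightarrow> 'a list set set" where
  "share_family \<Sigma> d n f b =
     (\<lambda>k. ca_preimage \<Sigma> d (f k) (no_boundary_ca d (f k) b)) ` {1..n}"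

end

theory Submission
  imports Defs
begin

text \<open>Orthogonality of the Cayley tables says that two distinct blocks cannot have the same image
  under two distinct automata of the family. As \<open>B\<^sub>i\<close> and \<open>B\<^sub>j\<close> have the same image under
  \<open>F\<^sub>S\<close>, any preimage under \<open>F\<^sub>k\<close> that contains both of them must come from \<open>k = S\<close>.\<close>

lemma nlists_split_half:
  assumes "x \<in> nlists (2 * m) A"
  shows "take m x \<in> nlists m A" and "drop m x \<in> nlists m A"
  using assms set_take_subset[of m x] set_drop_subset[of m x]
  unfolding nlists_def by (simp_all, blast+)

text \<open>Cutting a block in the middle turns it into a cell of the Cayley table: the left half is
  the row, the right half the column, and the entry is the image of the block. Distinct blocks are
  distinct cells, so agreement of the entries in both tables contradicts orthogonality.\<close>

lemma moca_collision_unique_rule: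
  assumes moca: "moca \<Sigma> d n f" and "k \<in> {1..n}" "l \<in> {1..n}"
    and x: "x \<in> nlists (2 * (d - 1)) \<Sigma>" and y: "y \<in> nlists (2 * (d - 1)) \<Sigma>" and "x \<noteq> y"
    and k: "no_boundary_ca d (f k) x = no_boundary_ca d (f k) y"
    and l: "no_boundary_ca d (f l) x = no_boundary_ca d (f l) y"
  shows "k = l"
proof (rule ccontr)
  assume "k \<noteq> l"
  then have "orthogonal_latin_squares (nlists (d - 1) \<Sigma>)
      (cayley_table d (f k)) (cayley_table d (f l))"
    using moca \<open>k \<in> {1..n}\<close> \<open>l \<in> {1..n}\<close> by (simp add: moca_def)
  moreover have "(take (d - 1) x, drop (d - 1) x) \<noteq> (take (d - 1) y, drop (d - 1) y)"
    using \<open>x \<noteq> y\<close> by (metis append_take_drop_id prod.inject)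
  ultimately have
    "(cayley_table d (f k) (take (d - 1) x) (drop (d - 1) x),
      cayley_table d (f l) (take (d - 1) x) (drop (d - 1) x)) \<noteq>
     (cayley_table d (f k) (take (d - 1) y) (drop (d - 1) y),
      cayley_table d (f l) (take (d - 1) y) (drop (d - 1) y))"
    using nlists_split_half[OF x] nlists_split_half[OF y]
    unfolding orthogonal_latin_squares_def by blast
  then show False
    using k l by (simp add: cayley_table_def)
qed

theorem lemma1:
  fixes \<Sigma> :: "'a set" and q d n S :: nat
    and f :: "nat \<Rightarrow> 'a list \<Rightarrow> 'a"
    and R :: "'a list" and B :: "nat \<Rightarrow> 'a list"
    and i j :: nat
  assumes "finite \<Sigma>" and "card \<Sigma> = q" and "d \<ge> 2"
    and "moca \<Sigma> d n f"
    and "S \<in> {1..n}" and "R \<in> nlists (d - 1) \<Sigma>"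
    and shares: "bij_betw B {1..q ^ (d - 1)} (ca_preimage \<Sigma> d (f S) R)"
    and "i \<in> {1..q ^ (d - 1)}" and "j \<in> {1..q ^ (d - 1)}" and "i \<noteq> j"
  shows "share_family \<Sigma> d n f (B i) \<inter> share_family \<Sigma> d n f (B j) = {ca_preimage \<Sigma> d (f S) R} \<and>
    (\<forall>k \<in> {1..n}. (\<exists>y \<in> nlists (d - 1) \<Sigma>. ca_preimage \<Sigma> d (f S) R = ca_preimage \<Sigma> d (f k) y)
        \<longleftrightarrow> k = S)"
proof -
  have mem: "B i \<in> ca_preimage \<Sigma> d (f S) R" "B j \<in> ca_preimage \<Sigma> d (f S) R"
    using bij_betwE[OF shares] assms(8,9) by blast+
  then have R: "no_boundary_ca d (f S) (B i) = R" "no_boundary_ca d (f S) (B j) = R"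
    and blocks: "B i \<in> nlists (2 * (d - 1)) \<Sigma>" "B j \<in> nlists (2 * (d - 1)) \<Sigma>"
    by (auto simp: ca_preimage_def)
  have "B i \<noteq> B j"
    using inj_on_eq_iff[OF bij_betw_imp_inj_on[OF shares] assms(8,9)] assms(10) by simp
  \<comment> \<open>The output \<open>y\<close> is left arbitrary so that this fact serves twice:
    for a common member of the two families, and for any other description of the dealer's set as a
    fibre.\<close>
  have unique: "k = S"
    if "k \<in> {1..n}" "B i \<in> ca_preimage \<Sigma> d (f k) y" "B j \<in> ca_preimage \<Sigma> d (f k) y" for k y
    using moca_collision_unique_rule[OF assms(4) that(1) assms(5) blocks \<open>B i \<noteq> B j\<close>] that R
    by (simp add: ca_preimage_def)
  have own: "b \<in> ca_preimage \<Sigma> d (f k) (no_boundary_ca d (f k) b)"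
    if "b \<in> nlists (2 * (d - 1)) \<Sigma>" for k b
    using that by (simp add: ca_preimage_def)
  have "A = ca_preimage \<Sigma> d (f S) R"
    if A: "A \<in> share_family \<Sigma> d n f (B i)" "A \<in> share_family \<Sigma> d n f (B j)" for A
  proof -
    obtain k l where k: "k \<in> {1..n}" "A = ca_preimage \<Sigma> d (f k) (no_boundary_ca d (f k) (B i))"
      and l: "A = ca_preimage \<Sigma> d (f l) (no_boundary_ca d (f l) (B j))"
      using A unfolding share_family_def by blast
    \<comment> \<open>As a member of the first family \<open>A\<close> is a fibre through
      \<open>B i\<close>, as a member of the second a fibre through \<open>B j\<close>, possibly
      under another rule \<open>l\<close>. It thus contains both shares, which forces
      \<open>k = S\<close>; the fibre of rule \<open>S\<close> through \<open>B i\<close> is the one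
      over \<open>R\<close>.\<close>
    have "B i \<in> A" "B j \<in> A"
      using own[OF blocks(1)] own[OF blocks(2)] k(2) l by blast+
    then have "k = S"
      using unique[OF k(1)] k(2) by simp
    then show ?thesis
      using k(2) R by simp
  qed
  \<comment> \<open>Conversely, the index \<open>S\<close> produces the dealer's set in both
    families, since both shares are mapped to \<open>R\<close>.\<close>
  moreover have "ca_preimage \<Sigma> d (f S) R \<in> share_family \<Sigma> d n f b"
    if "no_boundary_ca d (f S) b = R" for b
    unfolding share_family_def using assms(5) that by blast
  ultimately have "share_family \<Sigma> d n f (B i) \<inter> share_family \<Sigma> d n f (B j) =
      {ca_preimage \<Sigma> d (f S) R}"
    using R by blast
  moreover have "(\<exists>y \<in> nlists (d - 1) \<Sigma>. ca_preimage \<Sigma> d (f S) R = ca_preimage \<Sigma> d (f k) y)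
      \<longleftrightarrow> k = S" if "k \<in> {1..n}" for k
  proof
    assume "\<exists>y \<in> nlists (d - 1) \<Sigma>. ca_preimage \<Sigma> d (f S) R = ca_preimage \<Sigma> d (f k) y"
    then obtain y where "ca_preimage \<Sigma> d (f S) R = ca_preimage \<Sigma> d (f k) y"
      by (rule bexE)
    \<comment> \<open>Both shares lie in the dealer's set, hence in the equal fibre of rule
      \<open>k\<close>.\<close>
    then show "k = S"
      using unique[OF that] mem by simp
  \<comment> \<open>For \<open>k = S\<close> the witness is \<open>y = R\<close>.\<close>
  qed (use assms(6) in blast)
  ultimately show ?thesis by blast
qed

end
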